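(* Let $\delta>0$ and let $\mu$ be a $\delta$-ULC probability measure on $\mathbb N^d$ with finite second moments. Then $\mu$ is $1/\delta$-spectrally independent, that is, $$\mathrm{cov}(\mu)\;\preceq\;\frac1\delta\,\mathrm{diag}\big(\mathrm{mean}(\mu)\big).$$
   Context: $\mathbb N=\{0,1,2,\dots\}$, $[d]=\{1,\dots,d\}$, $\mathbf e_i$ is the $i$-th standard basis vector, $\mathbf n!=\prod_{i=1}^d n_i!$. $\preceq$ is the positive semidefinite order; $\mathrm{mean}(\mu)$ and $\mathrm{cov}(\mu)$ are the mean vector and covariance matrix of $\mu$; $\mathrm{diag}(\mathbf v)$ is the diagonal matrix with diagonal $\mathbf v$. A set $S\subseteq\mathbb N^d$ is downward closed if $\mathbf n\in S$ and $\mathbf 0\le\mathbf m\le\mathbf n$ (coordinatewise) imply $\mathbf m\in S$. Definition ($\delta$-ULC). A probability measure $\mu$ on $\mathbb N^d$ with downward closed support is $\delta$-ULC if, with $a(\mathbf n)=\mathbf n!\,\mu(\mathbf n)$ and $\mathcal I_{\mathbf n}=\{i\in[d]:\mathbf n+\mathbf e_i\in\mathrm{supp}(\mu)\}$, for every $\mathbf n\in\mathrm{supp}(\mu)$ $$\Big(1-\frac{a(\mathbf n)\,a(\mathbf n+\mathbf e_i+\mathbf e_j)}{a(\mathbf n+\mathbf e_i)\,a(\mathbf n+\mathbf e_j)}\Big)_{i,j\in\mathcal I_{\mathbf n}}+(1-\delta)\,\mathrm{diag}\Big(\frac{a(\mathbf n)}{a(\mathbf n+\mathbf e_i)}\Big)_{i\in\mathcal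 I_{\mathbf n}}\succeq 0 .$$ *)

theory Defs
  imports "HOL-Probability.Probability"
begin

text \<open>
  The space \<open>\<nat>\<^sup>d\<close> is \<open>nat ^ 'd\<close>, with the library's coordinatewise order; the \<open>i\<close>-th standard basis
  vector is \<open>axis i 1\<close>. Probability measures on it are given as \<open>pmf\<close>s.
\<close>

definition multifact :: "nat ^ 'd \<Rightarrow> nat" where
  "multifact n = (\<Prod>i\<in>UNIV. fact (n $ i))"

definition downward_closed :: "(nat ^ 'd) set \<Rightarrow> bool" where
  "downward_closed S \<longleftrightarrow> (\<forall>n\<in>S. \<forall>m. m \<le> n \<longrightarrow> m \<in> S)"

text \<open>
  Positive semidefiniteness of the symmetric real matrix \<open>(A i j)\<close> with rows and columns indexed by
  the finite set \<open>I\<close>; the values of \<open>A\<close> outside \<open>I \<times> I\<close> are irrelevant.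
\<close>

definition psd_on :: "'i set \<Rightarrow> ('i \<Rightarrow> 'i \<Rightarrow> real) \<Rightarrow> bool" where
  "psd_on I A \<longleftrightarrow>
     (\<forall>i\<in>I. \<forall>j\<in>I. A i j = A j i) \<and>
     (\<forall>v :: 'i \<Rightarrow> real. 0 \<le> (\<Sum>i\<in>I. \<Sum>j\<in>I. v i * A i j * v j))"

definition loewner_le :: "real ^ 'd ^ 'd \<Rightarrow> real ^ 'd ^ 'd \<Rightarrow> bool"  (infix "\<preceq>" 50) where
  "A \<preceq> B \<longleftrightarrow> psd_on UNIV (\<lambda>i j. (B - A) $ i $ j)"

definition diag :: "real ^ 'd \<Rightarrow> real ^ 'd ^ 'd" where
  "diag v = (\<chi> i j. if i = j then v $ i else 0)"

definition finite_second_moments :: "(nat ^ 'd) pmf \<Rightarrow> bool" where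
  "finite_second_moments \<mu> \<longleftrightarrow>
     (\<forall>i. integrable (measure_pmf \<mu>) (\<lambda>n. (real (n $ i))\<^sup>2))"

definition mean_vec :: "(nat ^ 'd) pmf \<Rightarrow> real ^ 'd" where
  "mean_vec \<mu> = (\<chi> i. measure_pmf.expectation \<mu> (\<lambda>n. real (n $ i)))"

definition cov_mat :: "(nat ^ 'd) pmf \<Rightarrow> real ^ 'd ^ 'd" where
  "cov_mat \<mu> = (\<chi> i j. measure_pmf.expectation \<mu>
     (\<lambda>n. (real (n $ i) - mean_vec \<mu> $ i) * (real (n $ j) - mean_vec \<mu> $ j)))"

definition ulc_weight :: "(nat ^ 'd) pmf \<Rightarrow> nat ^ 'd \<Rightarrow> real" where
  "ulc_weight \<mu> n = real (multifact n) * pmf \<mu> n"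

definition ulc_dirs :: "(nat ^ 'd) pmf \<Rightarrow> nat ^ 'd \<Rightarrow> 'd set" where
  "ulc_dirs \<mu> n = {i. n + axis i 1 \<in> set_pmf \<mu>}"

definition delta_ULC :: "real \<Rightarrow> (nat ^ 'd) pmf \<Rightarrow> bool" where
  "delta_ULC \<delta> \<mu> \<longleftrightarrow> downward_closed (set_pmf \<mu>) \<and>
     (\<forall>n\<in>set_pmf \<mu>. psd_on (ulc_dirs \<mu> n) (\<lambda>i j.
        (1 - (ulc_weight \<mu> n * ulc_weight \<mu> (n + axis i 1 + axis j 1)) /
             (ulc_weight \<mu> (n + axis i 1) * ulc_weight \<mu> (n + axis j 1)))
        + (1 - \<delta>) * (if i = j then ulc_weight \<mu> n / ulc_weight \<mu> (n + axis i 1) else 0)))"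

text \<open>
  Mean and covariance only have their usual meaning here when the second moments are finite.
\<close>

definition spectrally_independent :: "real \<Rightarrow> (nat ^ 'd) pmf \<Rightarrow> bool" where
  "spectrally_independent \<eta> \<mu> \<longleftrightarrow> cov_mat \<mu> \<preceq> \<eta> *\<^sub>R diag (mean_vec \<mu>)"

end

theory Submission
  imports Defs
begin

text \<open>
  Consider the birth-death chain on the support of \<open>\<mu>\<close> with death rates \<open>n\<^sub>i\<close> and birth rates
  \<open>a(n + e\<^sub>i) / a(n)\<close>; it is reversible with respect to \<open>\<mu>\<close>. After conjugation by the birth rates,
  \<open>\<delta>\<close>-ULC is exactly a curvature lower bound for this chain: Bochner's identity turns it into
  \<open>\<delta> \<cdot> \<E>(f, f) \<le> E[(L f)\<^sup>2]\<close>. On a finite support, solving the Poisson equation then gives the Poincare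
  inequality \<open>\<delta> \<cdot> Var(g) \<le> \<E>(g, g)\<close>, and for linear \<open>g\<close> the Dirichlet form is \<open>\<Sum>\<^sub>i v\<^sub>i\<^sup>2 E[n\<^sub>i]\<close>.

  For infinite support, restrict \<open>\<mu>\<close> to total degree at most \<open>K\<close> and let \<open>K\<close> tend to infinity. The restriction
  preserves the curvature bound when \<open>\<delta> \<le> 1\<close>. When \<open>\<delta> > 1\<close> the birth rate in direction \<open>i\<close> drops
  by at least \<open>\<delta> - 1\<close> with every birth in that direction, so the support is finite.
\<close>

declare One_nat_def [simp del]

subsection \<open>Least squares\<close>

text \<open>The normal equations are solvable even for linearly dependent \<open>\<phi>\<close>.
  This is Gram-Schmidt: the new vector is orthogonalised against the old ones, and the residual of
  \<open>g\<close> then loses its component along the result.\<close>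

lemma finite_least_squares:
  fixes w :: "'a \<Rightarrow> real" and \<phi> :: "'j \<Rightarrow> 'a \<Rightarrow> real" and g :: "'a \<Rightarrow> real"
  assumes "finite S" and w: "\<And>s. s \<in> S \<Longrightarrow> 0 < w s" and "finite J"
  shows "\<exists>x. \<forall>j\<in>J. (\<Sum>s\<in>S. w s * (g s - (\<Sum>k\<in>J. x k * \<phi> k s)) * \<phi> j s) = 0"
  using \<open>finite J\<close>
proof (induction J arbitrary: g rule: finite_induct)
  case empty
  then show ?case by simp
next
  case (insert l J)
  define ip where "ip p q = (\<Sum>s\<in>S. w s * p s * q s)" for p q :: "'a \<Rightarrow> real"
  have ip_comb: "ip (\<lambda>s. p s - t * q s) r = ip p r - t * ip q r" for p q r t
    by (simp add: ip_def algebra_simps sum_subtractf sum_distrib_left)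
  have ip_sum: "ip p (\<lambda>s. \<Sum>k\<in>J. y k * \<phi> k s) = (\<Sum>k\<in>J. y k * ip p (\<phi> k))" for p y
  proof -
    have "ip p (\<lambda>s. \<Sum>k\<in>J. y k * \<phi> k s) = (\<Sum>s\<in>S. \<Sum>k\<in>J. y k * (w s * p s * \<phi> k s))"
      by (simp add: ip_def sum_distrib_left mult_ac)
    also have "\<dots> = (\<Sum>k\<in>J. \<Sum>s\<in>S. y k * (w s * p s * \<phi> k s))"
      by (rule sum.swap)
    finally show ?thesis by (simp add: ip_def sum_distrib_left)
  qed
  obtain x where x: "\<forall>j\<in>J. ip (\<lambda>s. g s - (\<Sum>k\<in>J. x k * \<phi> k s)) (\<phi> j) = 0"
    using insert.IH[of g] unfolding ip_def by blast
  obtain y where y: "\<forall>j\<in>J. ip (\<lambda>s. \<phi> l s - (\<Sum>k\<in>J. y k * \<phi> k s)) (\<phi> j) = 0"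
    using insert.IH[of "\<phi> l"] unfolding ip_def by blast
  define r where "r s = g s - (\<Sum>k\<in>J. x k * \<phi> k s)" for s
  define q where "q s = \<phi> l s - (\<Sum>k\<in>J. y k * \<phi> k s)" for s
  define t where "t = ip r q / ip q q"
  \<comment> \<open>Coefficients of the old projection plus \<open>t * q\<close>, with
    \<open>q\<close> expanded in the \<open>\<phi>\<close>.\<close>
  define z where "z k = (if k = l then t else x k - t * y k)" for k
  define p where "p s = r s - t * q s" for s
  have p_orth: "ip p (\<phi> j) = 0" if "j \<in> J" for j
    using x y that unfolding p_def ip_comb r_def q_def by simp
  have p_q: "ip p q = 0"
  proof (cases "ip q q = 0")
    \<comment> \<open>Here \<open>t\<close> is 0 by division by zero, and positivity of the weights
      makes \<open>q\<close> vanish on \<open>S\<close>.\<close>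
    case True
    have "\<forall>s\<in>S. w s * q s * q s = 0"
      using True assms(1) w unfolding ip_def
      by (subst (asm) sum_nonneg_eq_0_iff) (simp_all add: mult.assoc less_imp_le)
    then have "\<forall>s\<in>S. q s = 0" using w by force
    then show ?thesis by (simp add: ip_def)
  next
    case False
    then show ?thesis unfolding p_def ip_comb t_def by simp
  qed
  have "ip p (\<phi> l) = ip p (\<lambda>s. q s + (\<Sum>k\<in>J. y k * \<phi> k s))"
    by (simp add: q_def)
  also have "\<dots> = ip p q + ip p (\<lambda>s. \<Sum>k\<in>J. y k * \<phi> k s)"
    by (simp add: ip_def algebra_simps sum.distrib)
  also have "\<dots> = 0" using p_q p_orth by (simp add: ip_sum)
  finally have p_l: "ip p (\<phi> l) = 0" .
  have "g s - (\<Sum>k\<in>insert l J. z k * \<phi> k s) = p s" for s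
  proof -
    have "(\<Sum>k\<in>J. z k * \<phi> k s) = (\<Sum>k\<in>J. x k * \<phi> k s) - t * (\<Sum>k\<in>J. y k * \<phi> k s)"
      using insert.hyps unfolding z_def sum_distrib_left sum_subtractf[symmetric]
      by (intro sum.cong) (auto simp: algebra_simps)
    then show ?thesis using insert.hyps by (simp add: p_def r_def q_def z_def algebra_simps)
  qed
  then show ?case using p_orth p_l by (intro exI[of _ z]) (auto simp: ip_def)
qed

subsection \<open>The birth-death generator\<close>

text \<open>The factor \<open>n $ i + 1\<close> is a quotient of factorials, so for
  \<open>m = pmf \<mu>\<close> this is a(n + e_i) / a(n). A general weight \<open>m\<close> also
  covers truncations.\<close>

definition birth_rate :: "(nat ^ 'd \<Rightarrow> real) \<Rightarrow> 'd \<Rightarrow> nat ^ 'd \<Rightarrow> real" where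
  "birth_rate m i n = real (n $ i + 1) * m (n + axis i 1) / m n"

definition discrete_grad :: "(nat ^ 'd \<Rightarrow> real) \<Rightarrow> 'd \<Rightarrow> nat ^ 'd \<Rightarrow> real" where
  "discrete_grad f i n = f (n + axis i 1) - f n"

text \<open>A death contributes minus the gradient at the lower point. At \<open>n $ i = 0\<close>
  truncated subtraction gives \<open>n - axis i 1 = n\<close>, harmless because the coefficient is
  zero.\<close>

definition generator :: "(nat ^ 'd \<Rightarrow> real) \<Rightarrow> (nat ^ 'd \<Rightarrow> real) \<Rightarrow> nat ^ 'd \<Rightarrow> real" where
  "generator m f n = (\<Sum>i\<in>UNIV. birth_rate m i n * discrete_grad f i n)
     - (\<Sum>i\<in>UNIV. real (n $ i) * discrete_grad f i (n - axis i 1))"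

text \<open>The quadratic form of the ULC matrix at the vector with entries
  \<open>birth_rate m i n * u i\<close>. In this scaling, directions that leave a downward closed
  support contribute zero, so the sums can run over all indices.\<close>

definition curvature_ge :: "real \<Rightarrow> (nat ^ 'd \<Rightarrow> real) \<Rightarrow> nat ^ 'd \<Rightarrow> bool" where
  "curvature_ge \<delta> m n \<longleftrightarrow> (\<forall>u :: 'd \<Rightarrow> real.
     0 \<le> (\<Sum>i\<in>UNIV. birth_rate m i n * u i)\<^sup>2
       - (\<Sum>i\<in>UNIV. \<Sum>j\<in>UNIV. birth_rate m j n * birth_rate m i (n + axis j 1) * u i * u j)
       + (1 - \<delta>) * (\<Sum>i\<in>UNIV. birth_rate m i n * (u i)\<^sup>2))"

lemma add_axis_minus_axis [simp]: "(n :: nat ^ 'd) + axis i 1 - axis i 1 = n"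
  by (simp add: vec_eq_iff)

lemma minus_axis_add_axis: "n $ i \<noteq> 0 \<Longrightarrow> (n :: nat ^ 'd) - axis i 1 + axis i 1 = n"
  by (auto simp: vec_eq_iff axis_def)

lemma le_add_axis: "(n :: nat ^ 'd) \<le> n + axis i 1"
  by (simp add: less_eq_vec_def)

lemma minus_axis_le: "(n :: nat ^ 'd) - axis i 1 \<le> n"
  by (simp add: less_eq_vec_def)

text \<open>The weight is not normalised, because truncating a probability measure may lose
  mass.\<close>

locale finite_birth_death =
  fixes S :: "(nat ^ 'd) set" and m :: "nat ^ 'd \<Rightarrow> real"
  assumes finite_S: "finite S" and down: "downward_closed S" and zero_in: "0 \<in> S"
    and pos: "\<And>n. n \<in> S \<Longrightarrow> 0 < m n" and zero: "\<And>n. n \<notin> S \<Longrightarrow> m n = 0"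
begin

abbreviation "b \<equiv> birth_rate m"
abbreviation "L \<equiv> generator m"

section \<open>Unnormalised expectation, reversibility and the Dirichlet form\<close>

definition E :: "(nat ^ 'd \<Rightarrow> real) \<Rightarrow> real" where
  "E h = (\<Sum>n\<in>S. m n * h n)"

definition dirichlet :: "(nat ^ 'd \<Rightarrow> real) \<Rightarrow> (nat ^ 'd \<Rightarrow> real) \<Rightarrow> real" where
  "dirichlet f g = (\<Sum>i\<in>UNIV. E (\<lambda>n. b i n * discrete_grad f i n * discrete_grad g i n))"

lemma downD: "n \<in> S \<Longrightarrow> k \<le> n \<Longrightarrow> k \<in> S"
  using down by (auto simp: downward_closed_def)

lemma E_add: "E (\<lambda>n. f n + g n) = E f + E g"
  by (simp add: E_def algebra_simps sum.distrib)

lemma E_diff: "E (\<lambda>n. f n - g n) = E f - E g"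
  by (simp add: E_def algebra_simps sum_subtractf)

lemma E_cmult: "E (\<lambda>n. c * f n) = c * E f"
  by (simp add: E_def sum_distrib_left mult_ac)

lemma E_sum: "E (\<lambda>n. \<Sum>i\<in>I. f i n) = (\<Sum>i\<in>I. E (f i))"
  unfolding E_def sum_distrib_left by (rule sum.swap)

lemma E_mono: "(\<And>n. n \<in> S \<Longrightarrow> f n \<le> g n) \<Longrightarrow> E f \<le> E g"
  unfolding E_def using pos by (intro sum_mono mult_left_mono) (auto intro: less_imp_le)

lemma E_cong: "(\<And>n. n \<in> S \<Longrightarrow> f n = g n) \<Longrightarrow> E f = E g"
  unfolding E_def by (intro sum.cong) auto

lemma E_nonneg: "(\<And>n. n \<in> S \<Longrightarrow> 0 \<le> f n) \<Longrightarrow> 0 \<le> E f"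
  using E_mono[of "\<lambda>_. 0" f] by (simp add: E_def)

lemma E_eq_0: "E f = 0 \<Longrightarrow> (\<And>n. n \<in> S \<Longrightarrow> 0 \<le> f n) \<Longrightarrow> n \<in> S \<Longrightarrow> f n = 0"
  unfolding E_def using finite_S pos
  by (subst (asm) sum_nonneg_eq_0_iff) (force intro: less_imp_le mult_nonneg_nonneg)+

lemma b_nonneg: "n \<in> S \<Longrightarrow> 0 \<le> b i n"
  using pos[of n] pos[of "n + axis i 1"] zero[of "n + axis i 1"]
  by (cases "n + axis i 1 \<in> S") (auto simp: birth_rate_def)

lemma b_pos: "n + axis i 1 \<in> S \<Longrightarrow> 0 < b i n"
  using pos[of "n + axis i 1"] pos[of n] downD[OF _ le_add_axis, of n i] by (simp add: birth_rate_def)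

text \<open>Detailed balance: m(n) b_i(n) = (n_i + 1) m(n + e_i) on \<open>S\<close>. Reindexing by
  a shift matches the two sums; the terms lost at \<open>n $ i = 0\<close> or at births out of
  \<open>S\<close> are zero.\<close>

lemma E_shift:
  "E (\<lambda>n. real (n $ i) * h n) = E (\<lambda>n. b i n * h (n + axis i 1))"
proof -
  have "E (\<lambda>n. real (n $ i) * h n) = (\<Sum>n | n \<in> S \<and> n $ i \<noteq> 0. m n * (real (n $ i) * h n))"
    unfolding E_def using finite_S by (intro sum.mono_neutral_right) auto
  also have "\<dots> = (\<Sum>n | n \<in> S \<and> n + axis i 1 \<in> S. m n * (b i n * h (n + axis i 1)))"
  proof (rule sum.reindex_bij_witness[of _ "\<lambda>n. n + axis i 1" "\<lambda>n. n - axis i 1"], goal_cases)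
    case (5 n)
    then have "n - axis i 1 \<in> S" using downD minus_axis_le by blast
    then have "0 < m (n - axis i 1)" by (rule pos)
    with 5 show ?case by (simp add: birth_rate_def minus_axis_add_axis)
  qed (use downD minus_axis_le in \<open>auto simp: minus_axis_add_axis\<close>)
  also have "\<dots> = E (\<lambda>n. b i n * h (n + axis i 1))"
    unfolding E_def using finite_S zero
    by (intro sum.mono_neutral_left) (auto simp: birth_rate_def)
  finally show ?thesis .
qed

lemma E_shift_minus:
  "E (\<lambda>n. real (n $ i) * (h (n - axis i 1) * k n)) = E (\<lambda>n. b i n * (h n * k (n + axis i 1)))"
  by (subst E_shift) simp

text \<open>Summation by parts: detailed balance moves the death terms one step up, where they join
  the birth terms to form the gradient of \<open>g\<close>.\<close>

lemma E_generator: "E (\<lambda>n. L f n * g n) = - dirichlet f g"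
proof -
  have "E (\<lambda>n. L f n * g n) =
      (\<Sum>i\<in>UNIV. E (\<lambda>n. b i n * (discrete_grad f i n * g n)))
      - (\<Sum>i\<in>UNIV. E (\<lambda>n. real (n $ i) * (discrete_grad f i (n - axis i 1) * g n)))"
    unfolding generator_def left_diff_distrib E_diff sum_distrib_right E_sum by (simp add: mult.assoc)
  also have "\<dots> = - dirichlet f g"
  proof -
    have "E (\<lambda>n. b i n * discrete_grad f i n * discrete_grad g i n)
      = E (\<lambda>n. b i n * (discrete_grad f i n * g (n + axis i 1))) - E (\<lambda>n. b i n * (discrete_grad f i n * g n))" for i
      unfolding E_diff[symmetric] discrete_grad_def[of g] by (simp add: algebra_simps)
    then show ?thesis
      unfolding E_shift_minus dirichlet_def by (simp add: sum_subtractf)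
  qed
  finally show ?thesis .
qed

lemma dirichlet_diff:
  "dirichlet (\<lambda>n. f n - c * g n) (\<lambda>n. f n - c * g n)
     = dirichlet f f - 2 * c * dirichlet g f + c\<^sup>2 * dirichlet g g"
proof -
  have "E (\<lambda>n. b i n * discrete_grad (\<lambda>n. f n - c * g n) i n * discrete_grad (\<lambda>n. f n - c * g n) i n)
    = E (\<lambda>n. b i n * discrete_grad f i n * discrete_grad f i n)
      - 2 * c * E (\<lambda>n. b i n * discrete_grad g i n * discrete_grad f i n)
      + c\<^sup>2 * E (\<lambda>n. b i n * discrete_grad g i n * discrete_grad g i n)" for i
  proof -
    have d: "discrete_grad (\<lambda>n. f n - c * g n) i n = discrete_grad f i n - c * discrete_grad g i n" for n
      by (simp add: discrete_grad_def right_diff_distrib)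
    have "E (\<lambda>n. b i n * discrete_grad (\<lambda>n. f n - c * g n) i n * discrete_grad (\<lambda>n. f n - c * g n) i n)
      = E (\<lambda>n. b i n * discrete_grad f i n * discrete_grad f i n
        - 2 * c * (b i n * discrete_grad g i n * discrete_grad f i n)
        + c\<^sup>2 * (b i n * discrete_grad g i n * discrete_grad g i n))"
      unfolding d by (simp add: power2_eq_square algebra_simps)
    then show ?thesis by (simp only: E_add E_diff E_cmult)
  qed
  then show ?thesis
    unfolding dirichlet_def sum_distrib_left sum_subtractf[symmetric] sum.distrib[symmetric] by simp
qed

lemma dirichlet_nonneg: "0 \<le> dirichlet f f"
  unfolding dirichlet_def
  by (intro sum_nonneg E_nonneg) (auto simp: b_nonneg mult.assoc)

text \<open>Every edge from n to n + e_i inside \<open>S\<close> has positive rate, so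
  \<open>f\<close> agrees at its ends. As \<open>S\<close> is downward closed, removing units one by
  one joins each point to 0 within \<open>S\<close>.\<close>

lemma dirichlet_eq_0_imp_const:
  assumes "dirichlet f f = 0" "n \<in> S"
  shows "f n = f 0"
proof -
  have step: "f (n + axis i 1) = f n" if n: "n + axis i 1 \<in> S" for n i
  proof -
    have "n \<in> S" using n downD le_add_axis by blast
    have e0: "E (\<lambda>n. b i n * discrete_grad f i n * discrete_grad f i n) = 0"
      using assms(1) unfolding dirichlet_def
      by (subst (asm) sum_nonneg_eq_0_iff) (auto intro!: E_nonneg simp: b_nonneg mult.assoc)
    have "b i n * discrete_grad f i n * discrete_grad f i n = 0"
      
      by (rule E_eq_0[OF e0 _ \<open>n \<in> S\<close>]) (simp add: b_nonneg mult.assoc)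
    then show ?thesis using b_pos[OF n] by (simp add: discrete_grad_def)
  qed
  show ?thesis using assms(2)
  proof (induction "\<Sum>i\<in>UNIV. n $ i" arbitrary: n rule: less_induct)
    case less
    show ?case
    proof (cases "n = 0")
      case False
      then obtain i where i: "n $ i \<noteq> 0" by (auto simp: vec_eq_iff)
      have "(\<Sum>j\<in>UNIV. (n - axis i 1) $ j) < (\<Sum>j\<in>UNIV. n $ j)"
        using i by (intro sum_strict_mono_ex1) (auto simp: axis_def intro!: exI[of _ i])
      then have "f (n - axis i 1) = f 0"
        by (rule less.hyps) (rule downD[OF less.prems minus_axis_le])
      then show ?thesis
        using step[of "n - axis i 1" i] less.prems i by (simp add: minus_axis_add_axis)
    qed simp
  qed
qed

text \<open>Both sides are a(n + e_i + e_j) / a(n), with a(n) = n! m(n): the intermediate weight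
  cancels, and if the intermediate point is outside \<open>S\<close>, then so is the
  endpoint.\<close>

lemma b_b_commute:
  assumes "n \<in> S"
  shows "b i n * b j (n + axis i 1) = b j n * b i (n + axis j 1)"
proof -
  have *: "b i n * b j (n + axis i 1) = real (n $ i + 1) * real ((n + axis i 1) $ j + 1) * m (n + axis i 1 + axis j 1) / m n"
    for i j
  proof (cases "n + axis i 1 \<in> S")
    case True
    then show ?thesis using pos by (force simp: birth_rate_def)
  next
    case False
    then have "n + axis i 1 + axis j 1 \<notin> S" using downD le_add_axis by blast
    then show ?thesis using False by (simp add: birth_rate_def zero)
  qed
  show ?thesis unfolding * by (cases "i = j") (simp_all add: axis_def add_ac)
qed

text \<open>
  Bochner's identity. The increments \<open>D\<^sub>i f(n + e\<^sub>j) - D\<^sub>i f(n)\<close> are symmetric in \<open>i\<close> and \<open>j\<close>, which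
  makes the second-order terms combine into squares.
\<close>

lemma E_generator_square:
  "E (\<lambda>n. (L f n)\<^sup>2) = E (\<lambda>n.
      (\<Sum>i\<in>UNIV. b i n * discrete_grad f i n)\<^sup>2
      - (\<Sum>i\<in>UNIV. \<Sum>j\<in>UNIV. b j n * b i (n + axis j 1) * discrete_grad f i n * discrete_grad f j n)
      + (\<Sum>i\<in>UNIV. b i n * (discrete_grad f i n)\<^sup>2)
      + (\<Sum>i\<in>UNIV. \<Sum>j\<in>UNIV. b j n * b i (n + axis j 1)
           * (discrete_grad f i (n + axis j 1) - discrete_grad f i n)\<^sup>2))"
proof -
  define u where "u = discrete_grad f"
  \<comment> \<open>\<open>X\<close> and \<open>Y\<close> are the birth and death parts of
    \<open>L f\<close>. Detailed balance removes every death factor from the products involving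
    \<open>Y\<close>.\<close>
  define X where "X n = (\<Sum>i\<in>UNIV. b i n * u i n)" for n
  define Y where "Y n = (\<Sum>i\<in>UNIV. real (n $ i) * u i (n - axis i 1))" for n
  have L: "(L f n)\<^sup>2 = (X n)\<^sup>2 - 2 * (Y n * X n) + Y n * Y n" for n
    unfolding generator_def X_def Y_def u_def by (simp add: power2_eq_square algebra_simps)
  have EY: "E (\<lambda>n. Y n * k n) = (\<Sum>j\<in>UNIV. E (\<lambda>n. b j n * (u j n * k (n + axis j 1))))" for k
    unfolding Y_def sum_distrib_right E_sum mult.assoc E_shift_minus ..
  have XY: "E (\<lambda>n. Y n * X n)
      = E (\<lambda>n. \<Sum>i\<in>UNIV. \<Sum>j\<in>UNIV. b j n * b i (n + axis j 1) * u i (n + axis j 1) * u j n)"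
  proof -
    have "E (\<lambda>n. Y n * X n) = (\<Sum>j\<in>UNIV. \<Sum>i\<in>UNIV.
        E (\<lambda>n. b j n * b i (n + axis j 1) * u i (n + axis j 1) * u j n))"
      unfolding EY X_def by (simp add: E_sum[symmetric] sum_distrib_left mult_ac)
    also have "\<dots> = (\<Sum>i\<in>UNIV. \<Sum>j\<in>UNIV.
        E (\<lambda>n. b j n * b i (n + axis j 1) * u i (n + axis j 1) * u j n))"
      by (rule sum.swap)
    finally show ?thesis by (simp only: E_sum)
  qed
  \<comment> \<open>A birth in direction j followed by a death in direction i. The diagonal case
    yields the extra \<open>u j n\<close>, the source of the term
    \<open>b i n * (u i n)\<^sup>2\<close> in the identity.\<close>
  have Yshift: "Y (n + axis j 1) = u j n + (\<Sum>i\<in>UNIV. real (n $ i) * u i (n - axis i 1 + axis j 1))" for n j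
  proof -
    have "real ((n + axis j 1) $ i) * u i (n + axis j 1 - axis i 1)
        = (if i = j then u j n else 0) + real (n $ i) * u i (n - axis i 1 + axis j 1)" for i
    proof (cases "n $ i = 0")
      case True
      then show ?thesis by (auto simp: axis_def)
    next
      case False
      then have "n + axis j 1 - axis i 1 = n - axis i 1 + axis j 1"
        by (auto simp: vec_eq_iff axis_def)
      then show ?thesis using False by (auto simp: axis_def algebra_simps minus_axis_add_axis)
    qed
    then show ?thesis unfolding Y_def by (simp add: sum.distrib)
  qed
  have YY: "E (\<lambda>n. Y n * Y n) = E (\<lambda>n. (\<Sum>i\<in>UNIV. b i n * (u i n)\<^sup>2)
      + (\<Sum>i\<in>UNIV. \<Sum>j\<in>UNIV. b i n * b j (n + axis i 1) * u i (n + axis j 1) * u j (n + axis i 1)))"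
  proof -
    have "E (\<lambda>n. Y n * Y n) = (\<Sum>j\<in>UNIV. E (\<lambda>n. b j n * (u j n)\<^sup>2)
       + (\<Sum>i\<in>UNIV. E (\<lambda>n. real (n $ i) * (u i (n - axis i 1 + axis j 1) * (b j n * u j n)))))"
      unfolding EY Yshift
      by (simp add: E_add[symmetric] E_sum[symmetric] algebra_simps sum_distrib_left power2_eq_square)
    also have "\<dots> = (\<Sum>j\<in>UNIV. E (\<lambda>n. b j n * (u j n)\<^sup>2))
       + (\<Sum>j\<in>UNIV. \<Sum>i\<in>UNIV. E (\<lambda>n. b i n * (u i (n + axis j 1) * (b j (n + axis i 1) * u j (n + axis i 1)))))"
      unfolding E_shift_minus[where h = "\<lambda>n. u _ (n + axis _ 1)"] sum.distrib ..
    also have "(\<Sum>j\<in>UNIV. \<Sum>i\<in>UNIV. E (\<lambda>n. b i n * (u i (n + axis j 1) * (b j (n + axis i 1) * u j (n + axis i 1)))))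
       = (\<Sum>i\<in>UNIV. \<Sum>j\<in>UNIV. E (\<lambda>n. b i n * b j (n + axis i 1) * u i (n + axis j 1) * u j (n + axis i 1)))"
      by (subst sum.swap) (simp add: mult_ac)
    finally show ?thesis by (simp only: E_sum E_add)
  qed
  have pointwise: "(X n)\<^sup>2 - 2 * (\<Sum>i\<in>UNIV. \<Sum>j\<in>UNIV. b j n * b i (n + axis j 1) * u i (n + axis j 1) * u j n)
        + ((\<Sum>i\<in>UNIV. b i n * (u i n)\<^sup>2)
      + (\<Sum>i\<in>UNIV. \<Sum>j\<in>UNIV. b i n * b j (n + axis i 1) * u i (n + axis j 1) * u j (n + axis i 1)))
     = (X n)\<^sup>2 - (\<Sum>i\<in>UNIV. \<Sum>j\<in>UNIV. b j n * b i (n + axis j 1) * u i n * u j n)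
        + (\<Sum>i\<in>UNIV. b i n * (u i n)\<^sup>2)
        + (\<Sum>i\<in>UNIV. \<Sum>j\<in>UNIV. b j n * b i (n + axis j 1) * (u i (n + axis j 1) - u i n)\<^sup>2)"
    if n: "n \<in> S" for n
  proof -
    define A where "A i j = b j n * b i (n + axis j 1) * u i (n + axis j 1) * u j n" for i j
    \<comment> \<open>Symmetrising the cross term reduces the claim to an identity for each pair (i,
      j).\<close>
    have "(\<Sum>i\<in>UNIV. \<Sum>j\<in>UNIV. A i j) = (\<Sum>i\<in>UNIV. \<Sum>j\<in>UNIV. A j i)"
      by (rule sum.swap)
    then have "2 * (\<Sum>i\<in>UNIV. \<Sum>j\<in>UNIV. A i j) = (\<Sum>i\<in>UNIV. \<Sum>j\<in>UNIV. A i j + A j i)"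
      by (simp add: sum.distrib)
    moreover have "b i n * b j (n + axis i 1) * u i (n + axis j 1) * u j (n + axis i 1) - (A i j + A j i)
       = b j n * b i (n + axis j 1) * (u i (n + axis j 1) - u i n)\<^sup>2
         - b j n * b i (n + axis j 1) * u i n * u j n" for i j
    proof -
      \<comment> \<open>With D the common mixed increment, (u_i + D)(u_j + D) - (u_i + D) u_j - (u_j
        + D) u_i = D^2 - u_i u_j.\<close>
      have e: "u j (n + axis i 1) = u j n + (u i (n + axis j 1) - u i n)"
        by (simp add: u_def discrete_grad_def add_ac)
      show ?thesis unfolding A_def b_b_commute[OF n, of i j] e
        by (simp add: power2_eq_square algebra_simps)
    qed
    then have "(\<Sum>i\<in>UNIV. \<Sum>j\<in>UNIV. b i n * b j (n + axis i 1) * u i (n + axis j 1) * u j (n + axis i 1)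
          - (A i j + A j i))
       = (\<Sum>i\<in>UNIV. \<Sum>j\<in>UNIV. b j n * b i (n + axis j 1) * (u i (n + axis j 1) - u i n)\<^sup>2
          - b j n * b i (n + axis j 1) * u i n * u j n)"
      by (simp only:)
    ultimately show ?thesis
      unfolding A_def[symmetric] sum_subtractf by linarith
  qed
  have "E (\<lambda>n. (L f n)\<^sup>2) = E (\<lambda>n. (X n)\<^sup>2) - 2 * E (\<lambda>n. Y n * X n) + E (\<lambda>n. Y n * Y n)"
    unfolding L E_add E_diff E_cmult ..
  also have "\<dots> = E (\<lambda>n. (X n)\<^sup>2 - (\<Sum>i\<in>UNIV. \<Sum>j\<in>UNIV. b j n * b i (n + axis j 1) * u i n * u j n)
        + (\<Sum>i\<in>UNIV. b i n * (u i n)\<^sup>2)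
        + (\<Sum>i\<in>UNIV. \<Sum>j\<in>UNIV. b j n * b i (n + axis j 1) * (u i (n + axis j 1) - u i n)\<^sup>2))"
    unfolding XY YY E_cmult[symmetric] E_diff[symmetric] E_add[symmetric]
    by (rule E_cong) (rule pointwise)
  finally show ?thesis by (simp add: X_def u_def)
qed

lemma dirichlet_le_generator_square:
  assumes "\<And>n. n \<in> S \<Longrightarrow> curvature_ge \<delta> m n"
  shows "\<delta> * dirichlet f f \<le> E (\<lambda>n. (L f n)\<^sup>2)"
proof -
  have "\<delta> * dirichlet f f = E (\<lambda>n. \<delta> * (\<Sum>i\<in>UNIV. b i n * (discrete_grad f i n)\<^sup>2))"
    by (simp add: dirichlet_def E_cmult E_sum power2_eq_square mult.assoc)
  also have "\<dots> \<le> E (\<lambda>n. (L f n)\<^sup>2)"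
    unfolding E_generator_square
  proof (rule E_mono)
    fix n assume n: "n \<in> S"
    have "0 \<le> (\<Sum>i\<in>UNIV. \<Sum>j\<in>UNIV. b j n * b i (n + axis j 1)
           * (discrete_grad f i (n + axis j 1) - discrete_grad f i n)\<^sup>2)"
    proof (intro sum_nonneg mult_nonneg_nonneg)
      fix i j
      show "0 \<le> b i (n + axis j 1)"
        \<comment> \<open>Outside \<open>S\<close> the rate is a division by \<open>m n = 0\<close>,
          hence 0.\<close>
        by (cases "n + axis j 1 \<in> S") (simp add: b_nonneg, simp add: birth_rate_def zero)
    qed (simp_all add: n b_nonneg)
    moreover note assms[OF n, unfolded curvature_ge_def, rule_format, of "\<lambda>i. discrete_grad f i n"]
    ultimately show "\<delta> * (\<Sum>i\<in>UNIV. b i n * (discrete_grad f i n)\<^sup>2) \<le>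
       (\<Sum>i\<in>UNIV. b i n * discrete_grad f i n)\<^sup>2
      - (\<Sum>i\<in>UNIV. \<Sum>j\<in>UNIV. b j n * b i (n + axis j 1) * discrete_grad f i n * discrete_grad f j n)
      + (\<Sum>i\<in>UNIV. b i n * (discrete_grad f i n)\<^sup>2)
      + (\<Sum>i\<in>UNIV. \<Sum>j\<in>UNIV. b j n * b i (n + axis j 1)
           * (discrete_grad f i (n + axis j 1) - discrete_grad f i n)\<^sup>2)"
      by (simp add: algebra_simps)
  qed
  finally show ?thesis .
qed

section \<open>Poisson equation and Poincare inequality\<close>

lemma L_sum: "L (\<lambda>n. \<Sum>k\<in>I. c k * f k n) n = (\<Sum>k\<in>I. c k * L (f k) n)"
proof -
  have "discrete_grad (\<lambda>n. \<Sum>k\<in>I. c k * f k n) i n = (\<Sum>k\<in>I. c k * discrete_grad (f k) i n)" for i n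
    by (simp add: discrete_grad_def sum_subtractf right_diff_distrib)
  moreover have "(\<Sum>i\<in>UNIV. p i * (\<Sum>k\<in>I. c k * q k i)) = (\<Sum>k\<in>I. c k * (\<Sum>i\<in>UNIV. p i * q k i))"
    for p :: "'d \<Rightarrow> real" and q
    unfolding sum_distrib_left by (subst sum.swap) (simp add: mult_ac)
  ultimately show ?thesis
    unfolding generator_def by (simp add: right_diff_distrib sum_subtractf)
qed

text \<open>Births out of \<open>S\<close> have rate zero, and deaths stay in \<open>S\<close> by
  downward closure.\<close>

lemma L_cong:
  assumes "\<And>n. n \<in> S \<Longrightarrow> f n = g n" "n \<in> S"
  shows "L f n = L g n"
proof -
  have "b i n * discrete_grad f i n = b i n * discrete_grad g i n" for i
    using assms by (cases "n + axis i 1 \<in> S") (simp_all add: discrete_grad_def birth_rate_def zero)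
  moreover have "real (n $ i) * discrete_grad f i (n - axis i 1) = real (n $ i) * discrete_grad g i (n - axis i 1)" for i
    using assms downD[OF \<open>n \<in> S\<close> minus_axis_le, of i]
    by (cases "n $ i = 0") (simp_all add: discrete_grad_def minus_axis_add_axis)
  ultimately show ?thesis unfolding generator_def by presburger
qed

text \<open>
  The least-squares residual of \<open>g\<close> against the range of \<open>L\<close> is orthogonal to that range, so it has
  zero Dirichlet energy and is constant; its mean vanishes, so it is zero.
\<close>

lemma poisson_equation:
  assumes "E g = 0"
  obtains f where "\<And>n. n \<in> S \<Longrightarrow> L f n = g n"
proof -
  \<comment> \<open>The images of the point indicators span the range of \<open>L\<close> on
    \<open>S\<close>.\<close>
  define \<phi> where "\<phi> k n = L (\<lambda>l. if l = k then 1 else 0) n" for k n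
  obtain x where x: "\<And>k. k \<in> S \<Longrightarrow> (\<Sum>n\<in>S. m n * (g n - (\<Sum>k\<in>S. x k * \<phi> k n)) * \<phi> k n) = 0"
    using finite_least_squares[where w = m and g = g and \<phi> = \<phi>, OF finite_S pos finite_S] by auto
  define f where "f n = (\<Sum>k\<in>S. x k * (if n = k then 1 else 0))" for n
  define r where "r n = g n - L f n" for n
  have Lf: "L f n = (\<Sum>k\<in>S. x k * \<phi> k n)" for n
    unfolding f_def \<phi>_def by (rule L_sum)
  have orth: "E (\<lambda>n. L (\<lambda>l. if l = k then 1 else 0) n * r n) = 0" if "k \<in> S" for k
    using x[OF that] unfolding E_def r_def Lf \<phi>_def[symmetric] by (simp add: mult_ac)
  \<comment> \<open>On \<open>S\<close> the residual is itself a combination of indicators, so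
    \<open>L r\<close> lies in the span orthogonal to \<open>r\<close>.\<close>
  have "E (\<lambda>n. L r n * r n) = E (\<lambda>n. (\<Sum>k\<in>S. r k * L (\<lambda>l. if l = k then 1 else 0) n) * r n)"
  proof (rule E_cong)
    fix n assume "n \<in> S"
    have "L r n = L (\<lambda>n. \<Sum>k\<in>S. r k * (if n = k then 1 else 0)) n"
      by (rule L_cong[OF _ \<open>n \<in> S\<close>]) (simp add: finite_S if_distrib cong: if_cong)
    then show "L r n * r n = (\<Sum>k\<in>S. r k * L (\<lambda>l. if l = k then 1 else 0) n) * r n"
      by (simp add: L_sum)
  qed
  also have "\<dots> = (\<Sum>k\<in>S. r k * E (\<lambda>n. L (\<lambda>l. if l = k then 1 else 0) n * r n))"
    unfolding sum_distrib_right E_sum mult.assoc E_cmult ..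
  also have "\<dots> = 0" using orth by simp
  finally have "dirichlet r r = 0" by (simp add: E_generator)
  then have r_const: "r n = r 0" if "n \<in> S" for n using that by (rule dirichlet_eq_0_imp_const)
  \<comment> \<open>Summation by parts against a constant: \<open>L f\<close> has mean zero, so
    \<open>r\<close> inherits the mean of \<open>g\<close>.\<close>
  have "E (\<lambda>n. L f n * 1) = 0"
    unfolding E_generator by (simp add: dirichlet_def discrete_grad_def E_def)
  then have "0 = E r" unfolding r_def E_diff by (simp add: assms)
  also have "E r = E (\<lambda>n. r 0 * 1)" using r_const by (intro E_cong) auto
  also have "\<dots> = r 0 * E (\<lambda>_. 1)" by (rule E_cmult)
  finally have "r 0 * E (\<lambda>_. 1) = 0" by simp
  moreover have "0 < E (\<lambda>_. 1)"
    unfolding E_def using finite_S zero_in pos by (intro sum_pos) auto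
  ultimately have "r n = 0" if "n \<in> S" for n using r_const[OF that] by simp
  then show ?thesis by (intro that[of f]) (simp add: r_def)
qed

text \<open>Duality: solve \<open>L f = h\<close> for the centred \<open>h\<close>, so that
  \<open>E (h\<^sup>2)\<close> is both \<open>E ((L f)\<^sup>2)\<close> and minus
  \<open>dirichlet f g\<close>. The usual inequality is multiplied by the squared total mass to fit
  unnormalised weights.\<close>

lemma poincare:
  assumes "\<And>n. n \<in> S \<Longrightarrow> curvature_ge \<delta> m n" "0 < \<delta>"
  shows "\<delta> * (E (\<lambda>_. 1) * E (\<lambda>n. (g n)\<^sup>2) - (E g)\<^sup>2) \<le> E (\<lambda>_. 1) * dirichlet g g"
proof -
  define Z where "Z = E (\<lambda>_. 1)"
  have Z: "0 < Z" unfolding Z_def E_def using finite_S zero_in pos by (intro sum_pos) auto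
  define h where "h n = g n - E g / Z" for n
  have E_const: "E (\<lambda>_. c) = c * Z" for c
    using E_cmult[of c "\<lambda>_. 1"] by (simp add: Z_def)
  have "E h = 0" unfolding h_def E_diff E_const using Z by simp
  then obtain f where f: "\<And>n. n \<in> S \<Longrightarrow> L f n = h n"
    using poisson_equation[of h] by blast
  define V where "V = E (\<lambda>n. (h n)\<^sup>2)"
  have "V = E (\<lambda>n. (g n)\<^sup>2 - 2 * (E g / Z) * g n + (E g / Z)\<^sup>2)"
    unfolding V_def h_def by (simp add: power2_eq_square algebra_simps)
  also have "\<dots> = E (\<lambda>n. (g n)\<^sup>2) - (E g)\<^sup>2 / Z"
    unfolding E_add E_diff E_cmult E_const using Z by (simp add: field_simps power2_eq_square)
  finally have V: "Z * V = Z * E (\<lambda>n. (g n)\<^sup>2) - (E g)\<^sup>2" using Z by (simp add: field_simps)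
  have "V = E (\<lambda>n. L f n * h n)" unfolding V_def using f by (intro E_cong) (simp add: power2_eq_square)
  also have "\<dots> = - dirichlet f g"
    unfolding E_generator by (simp add: dirichlet_def discrete_grad_def h_def)
  finally have Vfg: "dirichlet f g = - V" by simp
  have "E (\<lambda>n. (L f n)\<^sup>2) = V" unfolding V_def using f by (intro E_cong) simp
  then have "\<delta> * dirichlet f f \<le> V" using dirichlet_le_generator_square[OF assms(1), of f] by simp
  then have "\<delta> * (\<delta> * dirichlet f f) \<le> \<delta> * V" using assms(2) by (intro mult_left_mono) auto
  \<comment> \<open>The energy of g + \<delta> f. The mixed term is -2 \<delta> V and the last term
    is at most \<delta> V, which leaves \<delta> V \<le> \<open>dirichlet g g\<close>.\<close>
  moreover have "0 \<le> dirichlet g g - 2 * (-\<delta>) * dirichlet f g + (-\<delta>)\<^sup>2 * dirichlet f f"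
    unfolding dirichlet_diff[symmetric] by (rule dirichlet_nonneg)
  ultimately have "\<delta> * V \<le> dirichlet g g"
    unfolding Vfg by (simp add: power2_eq_square mult.assoc)
  then have "Z * (\<delta> * V) \<le> Z * dirichlet g g" using Z by (intro mult_left_mono) auto
  then show ?thesis unfolding Z_def[symmetric] V[symmetric] by (simp add: mult_ac)
qed

text \<open>A linear function has constant gradient \<open>v i\<close>, and \<open>E_shift\<close>
  with the constant 1 identifies the mean birth rate with the mean of \<open>n $ i\<close>.\<close>

lemma linear_poincare:
  assumes "\<And>n. n \<in> S \<Longrightarrow> curvature_ge \<delta> m n" "0 < \<delta>"
  shows "\<delta> * (E (\<lambda>_. 1) * E (\<lambda>n. (\<Sum>i\<in>UNIV. v i * real (n $ i))\<^sup>2) - (E (\<lambda>n. \<Sum>i\<in>UNIV. v i * real (n $ i)))\<^sup>2)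
    \<le> E (\<lambda>_. 1) * E (\<lambda>n. \<Sum>i\<in>UNIV. (v i)\<^sup>2 * real (n $ i))"
proof -
  define g where "g n = (\<Sum>i\<in>UNIV. v i * real (n $ i))" for n :: "nat ^ 'd"
  have grad: "discrete_grad g i n = v i" for i n
  proof -
    have "discrete_grad g i n = (\<Sum>j\<in>UNIV. if j = i then v j else 0)"
      unfolding discrete_grad_def g_def sum_subtractf[symmetric]
      by (intro sum.cong) (auto simp: axis_def algebra_simps)
    then show ?thesis by simp
  qed
  have "dirichlet g g = (\<Sum>i\<in>UNIV. (v i)\<^sup>2 * E (b i))"
    unfolding dirichlet_def grad E_cmult[symmetric] by (simp add: power2_eq_square mult_ac)
  also have "\<dots> = (\<Sum>i\<in>UNIV. (v i)\<^sup>2 * E (\<lambda>n. real (n $ i)))"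
    using E_shift[of _ "\<lambda>_. 1"] by simp
  also have "\<dots> = E (\<lambda>n. \<Sum>i\<in>UNIV. (v i)\<^sup>2 * real (n $ i))"
    by (simp add: E_sum E_cmult)
  finally show ?thesis using poincare[OF assms, of g] unfolding g_def by presburger
qed

end

subsection \<open>Curvature of ULC measures\<close>

lemma multifact_add_axis: "multifact (n + axis i 1) = (n $ i + 1) * multifact n"
proof -
  have "multifact (n + axis i 1) = (\<Prod>j\<in>UNIV. (if j = i then n $ i + 1 else 1) * fact (n $ j))"
    unfolding multifact_def by (intro prod.cong) (auto simp: axis_def fact_Suc[of "n $ i", unfolded Suc_eq_plus1])
  then show ?thesis by (simp add: multifact_def prod.distrib)
qed

lemma multifact_pos: "0 < multifact n"
  by (simp add: multifact_def prod_pos)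

lemma birth_rate_eq_ulc_weight:
  "birth_rate (pmf \<mu>) i n = ulc_weight \<mu> (n + axis i 1) / ulc_weight \<mu> n"
  using multifact_pos[of n] by (simp add: birth_rate_def ulc_weight_def multifact_add_axis)

text \<open>Testing the ULC matrix at \<open>b i * u i\<close> cancels its denominators and turns
  the second-order ratio into a product of two successive birth rates.\<close>

lemma delta_ULC_imp_curvature_ge:
  fixes \<mu> :: "(nat ^ 'd) pmf"
  assumes "delta_ULC \<delta> \<mu>" and n: "n \<in> set_pmf \<mu>"
  shows "curvature_ge \<delta> (pmf \<mu>) n"
  unfolding curvature_ge_def
proof
  fix u :: "'d \<Rightarrow> real"
  define I where "I = ulc_dirs \<mu> n"
  define a where "a = ulc_weight \<mu>"
  define b where "b i = birth_rate (pmf \<mu>) i n" for i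
  define c where "c i j = b j * birth_rate (pmf \<mu>) i (n + axis j 1)" for i j
  define T where "T i j = b i * u i * (b j * u j) - c i j * u i * u j
    + (1 - \<delta>) * (if i = j then b i * (u i)\<^sup>2 else 0)" for i j
  have down: "k \<in> set_pmf \<mu>" if "k + axis i 1 \<in> set_pmf \<mu>" for k i
    using assms(1) that le_add_axis unfolding delta_ULC_def downward_closed_def by blast
  have b_off: "b i = 0" if "i \<notin> I" for i
    using that by (simp add: b_def birth_rate_def I_def ulc_dirs_def set_pmf_iff)
  \<comment> \<open>If one birth leaves the support, so do both together, by downward
    closure.\<close>
  have c_off: "c i j = 0" if "i \<notin> I \<or> j \<notin> I" for i j
  proof (cases "j \<in> I")
    case True
    then have "n + axis i 1 \<notin> set_pmf \<mu>" using that by (simp add: I_def ulc_dirs_def)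
    then have "n + axis j 1 + axis i 1 \<notin> set_pmf \<mu>"
      using down[of "n + axis i 1" j] by (auto simp: add_ac)
    then show ?thesis by (simp add: c_def birth_rate_def set_pmf_iff)
  qed (simp add: c_def b_off)
  have a_pos: "0 < a k" if "k \<in> set_pmf \<mu>" for k
    using that multifact_pos[of k] by (simp add: a_def ulc_weight_def pmf_positive)
  have "psd_on I (\<lambda>i j. (1 - (a n * a (n + axis i 1 + axis j 1)) /
             (a (n + axis i 1) * a (n + axis j 1)))
        + (1 - \<delta>) * (if i = j then a n / a (n + axis i 1) else 0))"
    using assms unfolding delta_ULC_def I_def a_def by blast
  from this[unfolded psd_on_def, THEN conjunct2, rule_format, of "\<lambda>i. b i * u i"]
  have "0 \<le> (\<Sum>i\<in>I. \<Sum>j\<in>I. (b i * u i) * ((1 - (a n * a (n + axis i 1 + axis j 1)) /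
             (a (n + axis i 1) * a (n + axis j 1)))
        + (1 - \<delta>) * (if i = j then a n / a (n + axis i 1) else 0)) * (b j * u j))" .
  also have "\<dots> = (\<Sum>i\<in>I. \<Sum>j\<in>I. T i j)"
  proof (intro sum.cong refl)
    fix i j assume "i \<in> I" "j \<in> I"
    then have pos: "0 < a n" "0 < a (n + axis i 1)" "0 < a (n + axis j 1)"
      using n by (auto simp: I_def ulc_dirs_def intro: a_pos)
    have b: "b k = a (n + axis k 1) / a n" for k
      by (simp add: b_def a_def birth_rate_eq_ulc_weight)
    have c: "c i j = a (n + axis i 1 + axis j 1) / a n"
      using pos by (simp add: c_def b birth_rate_eq_ulc_weight a_def[symmetric] add_ac)
    show "(b i * u i) * ((1 - (a n * a (n + axis i 1 + axis j 1)) /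
             (a (n + axis i 1) * a (n + axis j 1)))
        + (1 - \<delta>) * (if i = j then a n / a (n + axis i 1) else 0)) * (b j * u j) = T i j"
      using pos unfolding T_def c b by (auto simp: field_simps power2_eq_square)
  qed
  also have "\<dots> = (\<Sum>i\<in>UNIV. \<Sum>j\<in>I. T i j)"
    by (rule sum.mono_neutral_left) (auto simp: T_def b_off c_off intro!: sum.neutral)
  also have "\<dots> = (\<Sum>i\<in>UNIV. \<Sum>j\<in>UNIV. T i j)"
    by (intro sum.cong refl sum.mono_neutral_left) (auto simp: T_def b_off c_off)
  also have "\<dots> = (\<Sum>i\<in>UNIV. b i * u i)\<^sup>2 - (\<Sum>i\<in>UNIV. \<Sum>j\<in>UNIV. c i j * u i * u j)
       + (1 - \<delta>) * (\<Sum>i\<in>UNIV. b i * (u i)\<^sup>2)"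
    unfolding T_def sum.distrib sum_subtractf power2_eq_square[of "sum _ _"] sum_product
    by (simp add: sum_distrib_left[symmetric])
  finally show "0 \<le> (\<Sum>i\<in>UNIV. birth_rate (pmf \<mu>) i n * u i)\<^sup>2
       - (\<Sum>i\<in>UNIV. \<Sum>j\<in>UNIV. birth_rate (pmf \<mu>) j n * birth_rate (pmf \<mu>) i (n + axis j 1) * u i * u j)
       + (1 - \<delta>) * (\<Sum>i\<in>UNIV. birth_rate (pmf \<mu>) i n * (u i)\<^sup>2)"
    by (simp add: b_def c_def)
qed

subsection \<open>Truncation\<close>

definition total_degree :: "nat ^ 'd \<Rightarrow> nat" where
  "total_degree n = (\<Sum>i\<in>UNIV. n $ i)"

definition truncate :: "nat \<Rightarrow> (nat ^ 'd \<Rightarrow> real) \<Rightarrow> nat ^ 'd \<Rightarrow> real" where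
  "truncate K m n = (if total_degree n \<le> K then m n else 0)"

lemma total_degree_add_axis [simp]: "total_degree (n + axis i 1) = total_degree n + 1"
  by (simp add: total_degree_def sum.distrib axis_def)

lemma total_degree_mono: "n \<le> k \<Longrightarrow> total_degree n \<le> total_degree k"
  by (auto simp: total_degree_def less_eq_vec_def intro: sum_mono)

lemma finite_total_degree_le: "finite {n :: nat ^ 'd. total_degree n \<le> K}"
proof (rule finite_subset)
  show "{n :: nat ^ 'd. total_degree n \<le> K} \<subseteq> (\<lambda>f. \<chi> i. f i) ` (UNIV \<rightarrow>\<^sub>E {..K})"
  proof
    fix n :: "nat ^ 'd" assume "n \<in> {n. total_degree n \<le> K}"
    then have "n $ i \<le> K" for i
      using member_le_sum[of i UNIV "\<lambda>i. n $ i"] by (simp add: total_degree_def)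
    then show "n \<in> (\<lambda>f. \<chi> i. f i) ` (UNIV \<rightarrow>\<^sub>E {..K})"
      by (intro image_eqI[of _ _ "\<lambda>i. n $ i"]) (auto simp: vec_eq_iff)
  qed
  show "finite ((\<lambda>f. (\<chi> i. f i) :: nat ^ 'd) ` (UNIV \<rightarrow>\<^sub>E {..K}))"
    by (intro finite_imageI finite_PiE) auto
qed

text \<open>From degree \<open>K\<close> on all births are off. At degree \<open>K - 1\<close> only
  the subtracted second-order term disappears, leaving a square and a sum that is nonnegative for
  \<delta> \<le> 1. Below that nothing changes.\<close>

lemma curvature_ge_truncate:
  assumes "curvature_ge \<delta> m n" "\<delta> \<le> 1" "\<And>k. 0 \<le> m k"
  shows "curvature_ge \<delta> (truncate K m) n"
proof -
  have nonneg: "0 \<le> birth_rate m i k" for i k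
    using assms(3) by (simp add: birth_rate_def)
  have birth_lt: "birth_rate (truncate K m) i k = birth_rate m i k" if "total_degree k < K" for i k
    using that by (simp add: birth_rate_def truncate_def)
  have birth_ge: "birth_rate (truncate K m) i k = 0" if "K \<le> total_degree k" for i k
    using that by (simp add: birth_rate_def truncate_def)
  consider "K \<le> total_degree n" | "total_degree n < K" "K \<le> total_degree n + 1" | "total_degree n + 1 < K"
    by linarith
  then show ?thesis
  proof cases
    case 1
    then show ?thesis by (simp add: curvature_ge_def birth_ge)
  next
    case 2
    then show ?thesis
      using assms(2) nonneg
      by (auto simp: curvature_ge_def birth_ge birth_lt intro!: add_nonneg_nonneg mult_nonneg_nonneg sum_nonneg)
  next
    case 3
    then show ?thesis using assms(1) by (simp add: curvature_ge_def birth_lt)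
  qed
qed

lemma curvature_ge_birth_rate_drop:
  assumes "curvature_ge \<delta> m n" "0 < birth_rate m i n"
  shows "birth_rate m i (n + axis i 1) \<le> birth_rate m i n - (\<delta> - 1)"
proof -
  \<comment> \<open>Testing at a basis vector gives b (b - b' + 1 - \<delta>) \<ge> 0, where b' is
    the rate after the birth.\<close>
  define u where "u j = (if j = i then 1 else 0 :: real)" for j
  have *: "(\<Sum>j\<in>UNIV. f j * u j) = f i" for f
    by (simp add: u_def if_distrib[of "\<lambda>x. _ * x"] cong: if_cong)
  have sq: "(u j)\<^sup>2 = u j" for j by (simp add: u_def)
  have dbl: "(\<Sum>k\<in>UNIV. \<Sum>j\<in>UNIV. birth_rate m j n * birth_rate m k (n + axis j 1) * u k * u j)
      = birth_rate m i n * birth_rate m i (n + axis i 1)"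
    unfolding * mult.assoc[of "birth_rate m i n"] sum_distrib_left[symmetric] ..
  have "0 \<le> birth_rate m i n * (birth_rate m i n - birth_rate m i (n + axis i 1) + (1 - \<delta>))"
    using assms(1)[unfolded curvature_ge_def, rule_format, of u]
    unfolding sq dbl * by (simp add: power2_eq_square algebra_simps)
  then show ?thesis using assms(2) by (simp add: zero_le_mult_iff)
qed

text \<open>Along an axis contained in the support the birth rate would stay positive while falling
  at least linearly. So each axis leaves the support, and downward closure bounds every
  coordinate.\<close>

lemma bounded_support_if_gt_1:
  assumes curv: "\<And>n. n \<in> set_pmf \<mu> \<Longrightarrow> curvature_ge \<delta> (pmf \<mu>) n"
    and down: "downward_closed (set_pmf \<mu>)" and "1 < \<delta>"
  obtains K where "\<And>n. n \<in> set_pmf \<mu> \<Longrightarrow> total_degree n \<le> K"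
proof -
  have "\<exists>k. axis i k \<notin> set_pmf \<mu>" for i
  proof (rule ccontr)
    assume "\<nexists>k. axis i k \<notin> set_pmf \<mu>"
    then have supp: "axis i k \<in> set_pmf \<mu>" for k by blast
    define r where "r k = birth_rate (pmf \<mu>) i (axis i k)" for k
    have Suc: "axis i k + axis i 1 = axis i (Suc k)" for k
      by (simp add: vec_eq_iff axis_def)
    have r_pos: "0 < r k" for k
      using supp by (simp add: r_def birth_rate_def Suc pmf_positive)
    have "r k \<le> r 0 - real k * (\<delta> - 1)" for k
    proof (induction k)
      case (Suc k)
      have "r (Suc k) \<le> r k - (\<delta> - 1)"
        using curvature_ge_birth_rate_drop[OF curv[OF supp] r_pos[unfolded r_def], of k]
        unfolding r_def \<open>\<And>k. axis i k + axis i 1 = axis i (Suc k)\<close> .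
      with Suc show ?case by (simp add: algebra_simps)
    qed simp
    moreover obtain k where "r 0 < real k * (\<delta> - 1)"
      using reals_Archimedean3[of "\<delta> - 1"] \<open>1 < \<delta>\<close> by auto
    ultimately show False using r_pos[of k] by (smt (verit))
  qed
  then obtain k where k: "\<And>i. axis i (k i) \<notin> set_pmf \<mu>" by metis
  have "total_degree n \<le> (\<Sum>i\<in>UNIV. k i)" if "n \<in> set_pmf \<mu>" for n
    unfolding total_degree_def
  proof (rule sum_mono, rule ccontr)
    fix i assume "\<not> n $ i \<le> k i"
    then have "axis i (k i) \<le> n" by (simp add: less_eq_vec_def axis_def)
    then show False using k down that unfolding downward_closed_def by blast
  qed
  then show ?thesis by (rule that)
qed

text \<open>For \<delta> \<le> 1 every \<open>K\<close> works; for \<delta> > 1 the support is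
  bounded, so truncation at large \<open>K\<close> changes nothing.\<close>

lemma truncate_curvature_ge_eventually:
  assumes "delta_ULC \<delta> \<mu>"
  shows "\<forall>\<^sub>F K in sequentially. \<forall>n\<in>set_pmf \<mu>. curvature_ge \<delta> (truncate K (pmf \<mu>)) n"
proof (cases "\<delta> \<le> 1")
  case True
  then show ?thesis
    using assms by (auto intro!: always_eventually curvature_ge_truncate delta_ULC_imp_curvature_ge)
next
  case False
  then obtain K where K: "\<And>n. n \<in> set_pmf \<mu> \<Longrightarrow> total_degree n \<le> K"
    using bounded_support_if_gt_1[of \<mu> \<delta>] delta_ULC_imp_curvature_ge[OF assms] assms
    unfolding delta_ULC_def by (metis not_le)
  have "truncate k (pmf \<mu>) = pmf \<mu>" if "K \<le> k" for k
  proof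
    fix n
    show "truncate k (pmf \<mu>) n = pmf \<mu> n"
      using K[of n] that by (cases "n \<in> set_pmf \<mu>") (auto simp: truncate_def set_pmf_iff)
  qed
  then show ?thesis
    using delta_ULC_imp_curvature_ge[OF assms] by (intro eventually_sequentiallyI[of K]) simp
qed

section \<open>Passage to the limit\<close>

lemma truncated_sum_tendsto_expectation:
  assumes "integrable (measure_pmf \<mu>) h"
  shows "(\<lambda>K. \<Sum>n | n \<in> set_pmf \<mu> \<and> total_degree n \<le> K. truncate K (pmf \<mu>) n * h n)
    \<longlonglongrightarrow> measure_pmf.expectation \<mu> h"
proof -
  have "(\<Sum>n | n \<in> set_pmf \<mu> \<and> total_degree n \<le> K. truncate K (pmf \<mu>) n * h n)
      = measure_pmf.expectation \<mu> (\<lambda>n. if total_degree n \<le> K then h n else 0)" for K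
    by (subst integral_measure_pmf_real[where A = "{n. n \<in> set_pmf \<mu> \<and> total_degree n \<le> K}"])
      (auto intro: finite_subset[OF _ finite_total_degree_le[of K]] simp: truncate_def mult_ac split: if_splits)
  moreover have "(\<lambda>K. measure_pmf.expectation \<mu> (\<lambda>n. if total_degree n \<le> K then h n else 0))
      \<longlonglongrightarrow> measure_pmf.expectation \<mu> h"
  proof (rule integral_dominated_convergence[where w = "\<lambda>n. \<bar>h n\<bar>"])
    \<comment> \<open>At a fixed \<open>n\<close> the cutoff is inactive once \<open>K\<close>
      reaches its degree.\<close>
    show "AE n in measure_pmf \<mu>. (\<lambda>K. if total_degree n \<le> K then h n else 0) \<longlonglongrightarrow> h n"
      by (intro AE_I2 tendsto_eventually) (auto simp: eventually_sequentially)
  qed (use assms in auto)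
  ultimately show ?thesis by simp
qed

lemma finite_birth_death_truncate:
  assumes "downward_closed (set_pmf \<mu>)"
  shows "finite_birth_death {n. n \<in> set_pmf \<mu> \<and> total_degree n \<le> K} (truncate K (pmf \<mu>))"
proof
  show "finite {n. n \<in> set_pmf \<mu> \<and> total_degree n \<le> K}"
    by (rule finite_subset[OF _ finite_total_degree_le[of K]]) auto
  show "downward_closed {n. n \<in> set_pmf \<mu> \<and> total_degree n \<le> K}"
    using assms total_degree_mono unfolding downward_closed_def by (blast intro: order_trans)
  obtain n where "n \<in> set_pmf \<mu>" using set_pmf_not_empty[of \<mu>] by blast
  moreover have "0 \<le> n" by (simp add: less_eq_vec_def)
  ultimately show "0 \<in> {n. n \<in> set_pmf \<mu> \<and> total_degree n \<le> K}"
    using assms unfolding downward_closed_def by (auto simp: total_degree_def)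
qed (auto simp: truncate_def pmf_positive set_pmf_iff)

lemma delta_ULC_linear_poincare:
  fixes v :: "'d::finite \<Rightarrow> real"
  defines "g \<equiv> \<lambda>n :: nat ^ 'd. \<Sum>i\<in>UNIV. v i * real (n $ i)"
    and "q \<equiv> \<lambda>n :: nat ^ 'd. \<Sum>i\<in>UNIV. (v i)\<^sup>2 * real (n $ i)"
  assumes "0 < \<delta>" "delta_ULC \<delta> \<mu>"
    and int: "integrable (measure_pmf \<mu>) g" "integrable (measure_pmf \<mu>) (\<lambda>n. (g n)\<^sup>2)"
      "integrable (measure_pmf \<mu>) q"
  shows "\<delta> * (measure_pmf.expectation \<mu> (\<lambda>n. (g n)\<^sup>2) - (measure_pmf.expectation \<mu> g)\<^sup>2)
    \<le> measure_pmf.expectation \<mu> q"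
proof -
  define F where "F K h = (\<Sum>n | n \<in> set_pmf \<mu> \<and> total_degree n \<le> K. truncate K (pmf \<mu>) n * h n)" for K h
  have lim: "(\<lambda>K. F K h) \<longlonglongrightarrow> measure_pmf.expectation \<mu> h" if "integrable (measure_pmf \<mu>) h" for h
    using truncated_sum_tendsto_expectation[OF that] by (simp add: F_def)
  \<comment> \<open>The truncated masses \<open>F K (\<lambda>_. 1)\<close> stay in the inequality
    and tend to 1.\<close>
  have "\<forall>\<^sub>F K in sequentially. \<delta> * (F K (\<lambda>_. 1) * F K (\<lambda>n. (g n)\<^sup>2) - (F K g)\<^sup>2) \<le> F K (\<lambda>_. 1) * F K q"
    using truncate_curvature_ge_eventually[OF assms(4)]
  proof eventually_elim
    case (elim K)
    interpret finite_birth_death "{n. n \<in> set_pmf \<mu> \<and> total_degree n \<le> K}" "truncate K (pmf \<mu>)"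
      using assms(4) unfolding delta_ULC_def by (intro finite_birth_death_truncate) blast
    show ?case
      using linear_poincare[of \<delta> v] elim \<open>0 < \<delta>\<close> unfolding F_def E_def g_def q_def by simp
  qed
  moreover have "(\<lambda>K. \<delta> * (F K (\<lambda>_. 1) * F K (\<lambda>n. (g n)\<^sup>2) - (F K g)\<^sup>2)) \<longlonglongrightarrow>
      \<delta> * (measure_pmf.expectation \<mu> (\<lambda>_. 1) * measure_pmf.expectation \<mu> (\<lambda>n. (g n)\<^sup>2) - (measure_pmf.expectation \<mu> g)\<^sup>2)"
    by (intro tendsto_intros lim int) simp
  moreover have "(\<lambda>K. F K (\<lambda>_. 1) * F K q) \<longlonglongrightarrow> measure_pmf.expectation \<mu> (\<lambda>_. 1) * measure_pmf.expectation \<mu> q"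
    by (intro tendsto_intros lim int) simp
  ultimately have "\<delta> * (measure_pmf.expectation \<mu> (\<lambda>_. 1) * measure_pmf.expectation \<mu> (\<lambda>n. (g n)\<^sup>2) - (measure_pmf.expectation \<mu> g)\<^sup>2)
    \<le> measure_pmf.expectation \<mu> (\<lambda>_. 1) * measure_pmf.expectation \<mu> q"
    by (intro tendsto_le[OF sequentially_bot])
  then show ?thesis by simp
qed

section \<open>From variances of linear functions to the covariance matrix\<close>

theorem corollary4p17:
  fixes \<delta> :: real and \<mu> :: "(nat ^ 'd) pmf"
  assumes "\<delta> > 0"
    and "delta_ULC \<delta> \<mu>"
    and "finite_second_moments \<mu>"
  shows "spectrally_independent (1 / \<delta>) \<mu>"
  unfolding spectrally_independent_def loewner_le_def psd_on_def
proof (intro conjI ballI allI)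
  fix i j
  show "((1 / \<delta>) *\<^sub>R diag (mean_vec \<mu>) - cov_mat \<mu>) $ i $ j
      = ((1 / \<delta>) *\<^sub>R diag (mean_vec \<mu>) - cov_mat \<mu>) $ j $ i"
    by (simp add: diag_def cov_mat_def mult.commute)
next
  fix v :: "'d \<Rightarrow> real"
  let ?E = "measure_pmf.expectation \<mu>"
  have int2: "integrable (measure_pmf \<mu>) (\<lambda>n. (real (n $ i))\<^sup>2)" for i
    using assms(3) by (simp add: finite_second_moments_def)
  have int1: "integrable (measure_pmf \<mu>) (\<lambda>n. real (n $ i))" for i
  proof (rule Bochner_Integration.integrable_bound[OF int2[of i]])
    \<comment> \<open>Integrality of the coordinates lets second moments dominate first moments
      pointwise.\<close>
    have "real k \<le> (real k)\<^sup>2" for k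
      by (cases k) (simp_all add: power2_eq_square algebra_simps)
    then show "AE n in measure_pmf \<mu>. norm (real (n $ i)) \<le> norm ((real (n $ i))\<^sup>2)" by simp
  qed simp
  have int11: "integrable (measure_pmf \<mu>) (\<lambda>n. real (n $ i) * real (n $ j))" for i j
  proof (rule Bochner_Integration.integrable_bound)
    show "integrable (measure_pmf \<mu>) (\<lambda>n. (real (n $ i))\<^sup>2 + (real (n $ j))\<^sup>2)"
      using int2 by simp
    have "x * y \<le> x\<^sup>2 + y\<^sup>2" if "0 \<le> x" "0 \<le> y" for x y :: real
      using sum_squares_bound[of x y] mult_nonneg_nonneg[OF that] by linarith
    then show "AE n in measure_pmf \<mu>. norm (real (n $ i) * real (n $ j)) \<le> norm ((real (n $ i))\<^sup>2 + (real (n $ j))\<^sup>2)"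
      by simp
  qed simp
  define g where "g n = (\<Sum>i\<in>UNIV. v i * real (n $ i))" for n :: "nat ^ 'd"
  have mean: "mean_vec \<mu> $ i = ?E (\<lambda>n. real (n $ i))" for i by (simp add: mean_vec_def)
  have g2: "(g n)\<^sup>2 = (\<Sum>i\<in>UNIV. \<Sum>j\<in>UNIV. v i * v j * (real (n $ i) * real (n $ j)))" for n
    by (simp add: g_def power2_eq_square sum_product mult_ac)
  have cov: "cov_mat \<mu> $ i $ j = ?E (\<lambda>n. real (n $ i) * real (n $ j)) - mean_vec \<mu> $ i * mean_vec \<mu> $ j" for i j
  proof -
    have "cov_mat \<mu> $ i $ j = ?E (\<lambda>n. real (n $ i) * real (n $ j) - mean_vec \<mu> $ j * real (n $ i)
        - mean_vec \<mu> $ i * real (n $ j) + mean_vec \<mu> $ i * mean_vec \<mu> $ j)"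
      by (simp add: cov_mat_def algebra_simps)
    also have "\<dots> = ?E (\<lambda>n. real (n $ i) * real (n $ j)) - mean_vec \<mu> $ j * mean_vec \<mu> $ i
        - mean_vec \<mu> $ i * mean_vec \<mu> $ j + mean_vec \<mu> $ i * mean_vec \<mu> $ j"
      using int1 int11 by (simp add: mean)
    finally show ?thesis by simp
  qed
  have Eg: "?E g = (\<Sum>i\<in>UNIV. v i * mean_vec \<mu> $ i)"
    unfolding g_def mean using int1 by (subst Bochner_Integration.integral_sum) auto
  have Eg2: "?E (\<lambda>n. (g n)\<^sup>2) = (\<Sum>i\<in>UNIV. \<Sum>j\<in>UNIV. v i * v j * ?E (\<lambda>n. real (n $ i) * real (n $ j)))"
    unfolding g2 using int11 by (simp add: Bochner_Integration.integral_sum)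
  have Eq: "?E (\<lambda>n. \<Sum>i\<in>UNIV. (v i)\<^sup>2 * real (n $ i)) = (\<Sum>i\<in>UNIV. (v i)\<^sup>2 * mean_vec \<mu> $ i)"
    unfolding mean using int1 by (simp add: Bochner_Integration.integral_sum)
  \<comment> \<open>The variance of the linear function \<open>g\<close> is the covariance form at
    \<open>v\<close>, so the linear Poincare inequality is the desired matrix bound.\<close>
  have var: "?E (\<lambda>n. (g n)\<^sup>2) - (?E g)\<^sup>2 = (\<Sum>i\<in>UNIV. \<Sum>j\<in>UNIV. v i * cov_mat \<mu> $ i $ j * v j)"
    unfolding Eg2 Eg power2_eq_square[of "sum _ _"] sum_product sum_subtractf[symmetric]
    by (intro sum.cong refl) (simp add: cov algebra_simps)
  have "integrable (measure_pmf \<mu>) (\<lambda>n. (g n)\<^sup>2)"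
    unfolding g2 using int11 by simp
  then have "\<delta> * (?E (\<lambda>n. (g n)\<^sup>2) - (?E g)\<^sup>2) \<le> (\<Sum>i\<in>UNIV. (v i)\<^sup>2 * mean_vec \<mu> $ i)"
    using delta_ULC_linear_poincare[OF assms(1,2), of v] int1 unfolding Eq g_def by simp
  then have "(\<Sum>i\<in>UNIV. \<Sum>j\<in>UNIV. v i * cov_mat \<mu> $ i $ j * v j) \<le> 1 / \<delta> * (\<Sum>i\<in>UNIV. (v i)\<^sup>2 * mean_vec \<mu> $ i)"
    using assms(1) unfolding var by (simp add: field_simps)
  also have "\<dots> = (\<Sum>i\<in>UNIV. \<Sum>j\<in>UNIV. v i * ((1 / \<delta>) *\<^sub>R diag (mean_vec \<mu>)) $ i $ j * v j)"
  proof -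
    have "v i * ((1 / \<delta>) *\<^sub>R diag (mean_vec \<mu>)) $ i $ j * v j
        = (if i = j then 1 / \<delta> * ((v i)\<^sup>2 * mean_vec \<mu> $ i) else 0)" for i j
      by (simp add: diag_def power2_eq_square)
    then show ?thesis by (simp add: sum_distrib_left)
  qed
  finally show "0 \<le> (\<Sum>i\<in>UNIV. \<Sum>j\<in>UNIV. v i * ((1 / \<delta>) *\<^sub>R diag (mean_vec \<mu>) - cov_mat \<mu>) $ i $ j * v j)"
    by (simp add: algebra_simps sum_subtractf)
qed

end
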